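(* Let $m$, $n$, $k$ be positive integers. Then $$\bigl|L_k(\mathcal{S}^m_n)\bigr|=m^{n-k}\,\frac{n!\,(n-1)!}{k!\,(k-1)!\,(n-k)!},$$ where the right-hand side is interpreted as $0$ if $k>n$.
   Context: For $m\ge 1$, the extended Shi arrangement is $\mathcal{S}^m_n=\{\{x_i-x_j=a\}:1\le i<j\le n,\ a\in\mathbb{Z},\ 1-m\le a\le m\}$ in $\mathbb{R}^n$. A flat of an arrangement $\mathcal{A}$ is a nonempty intersection of hyperplanes of $\mathcal{A}$ (including the ambient space as the empty intersection); $L_k(\mathcal{A})$ is the set of flats of dimension $k$. *)

theory Defs
  imports "HOL-Analysis.Analysis"
begin

text \<open>
  Vectors in n-dimensional space are indexed by a finite linearly ordered type \<open>'n\<close> with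
  \<open>CARD('n)\<close> elements, which plays the role of the index set \<open>{1, ..., n}\<close>: a finite linear
  order is isomorphic to it in exactly one way.
\<close>

definition ext_shi_arrangement :: "nat \<Rightarrow> (real ^ 'n::{finite,linorder}) set set" where
  "ext_shi_arrangement m =
     {{x. x $ i - x $ j = of_int a} | i j a. i < j \<and> 1 - int m \<le> a \<and> a \<le> int m}"

text \<open>The choice \<open>B = {}\<close> gives the ambient space, as \<open>\<Inter>{} = UNIV\<close>.\<close>

definition flats :: "'a set set \<Rightarrow> 'a set set" where
  "flats A = {\<Inter>B | B. B \<subseteq> A \<and> \<Inter>B \<noteq> {}}"

definition flats_of_dim :: "nat \<Rightarrow> 'a::euclidean_space set set \<Rightarrow> 'a set set" where
  "flats_of_dim k A = {F \<in> flats A. aff_dim F = int k}"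

lemma finite_ext_shi_arrangement:
  "finite (ext_shi_arrangement m :: (real ^ 'n::{finite,linorder}) set set)"
proof -
  have "(ext_shi_arrangement m :: (real ^ 'n::{finite,linorder}) set set) \<subseteq>
    (\<lambda>(i, j, a). {x :: real ^ 'n::{finite,linorder}. x $ i - x $ j = of_int a}) `
      (UNIV \<times> UNIV \<times> {1 - int m..int m})"
    by (force simp: ext_shi_arrangement_def)
  then show ?thesis
    by (rule finite_subset) simp
qed

text \<open>In particular \<^const>\<open>card\<close> of the following set is a genuine cardinality.\<close>

lemma finite_flats_ext_shi:
  "finite (flats_of_dim k (ext_shi_arrangement m :: (real ^ 'n::{finite,linorder}) set set))"
proof -
  have "flats_of_dim k (ext_shi_arrangement m :: (real ^ 'n::{finite,linorder}) set set)
      \<subseteq> Inter ` Pow (ext_shi_arrangement m)"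
    by (auto simp: flats_of_dim_def flats_def)
  then show ?thesis
    by (rule finite_subset) (simp add: finite_ext_shi_arrangement)
qed

end

theory Submission imports Defs begin

text \<open>
  On a flat, certain coordinates differ by constants, so a flat splits the indices into blocks
  and places the indices of a block at integer heights, up to translation. Break ties between
  equal heights by the order of the indices. For \<open>i < j\<close>, an integer difference \<open>x\<^sub>i - x\<^sub>j\<close> lies
  between \<open>1 - m\<close> and \<open>m\<close> exactly when \<open>i\<close> and \<open>j\<close> are at distance below \<open>m\<close> once the height of
  each \<open>l\<close> is perturbed to \<open>x\<^sub>l + \<epsilon> l\<close> with a small \<open>\<epsilon> > 0\<close>. Hence the hyperplanes containing
  the flat form an interval graph, which is connected on a block exactly when any two consecutive
  indices in the sorted order of the block are that close. Given which of two neighbours \<open>a\<close>, \<open>b\<close> comes first, their height difference is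
  \<open>g + [b < a]\<close>, where \<open>g\<close> takes one of the \<open>m\<close> values \<open>0, \<dots>, m - 1\<close> whatever the order of
  the two indices. A flat is therefore the same as a set of disjoint directed paths on the
  indices whose arcs carry labels below \<open>m\<close>; the lemmas \<open>arcs_of_flat_of\<close> and
  \<open>flat_is_flat_of\<close> make this a bijection, and by \<open>flat_of_dim\<close> every arc lowers the dimension
  by one.

  It remains to count labelled path forests with \<open>e\<close> arcs on \<open>n\<close> vertices. Such a forest
  has \<open>n - e\<close> paths, so a further arc can be added in \<open>m (n - e) (n - e - 1)\<close> ways: it goes from
  the end of one path to the start of another. Counting the pairs of a forest with \<open>e + 1\<close> arcs
  and one of its arcs in two ways gives
  \<open>(e + 1) f(e + 1) = m (n - e) (n - e - 1) f(e)\<close>, whence the formula with \<open>e = n - k\<close>.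
\<close>

section \<open>Counting labelled path forests\<close>

definition link_rel :: "('a \<times> 'a \<times> 'c) set \<Rightarrow> ('a \<times> 'a) set" where
  "link_rel S = {(a, b). \<exists>g. (a, b, g) \<in> S}"

text \<open>
  A triple \<open>(a, b, g)\<close> is an arc from \<open>a\<close> to \<open>b\<close> with label \<open>g\<close>. Injectivity of the two
  projections bounds all in- and out-degrees by one and also excludes parallel arcs that differ
  only in their labels; without cycles, the components are then directed paths.
\<close>

definition path_forest :: "nat \<Rightarrow> ('a \<times> 'a \<times> nat) set \<Rightarrow> bool" where
  "path_forest m S \<longleftrightarrow> (\<forall>(a, b, g) \<in> S. g < m) \<and> inj_on fst S \<and> inj_on (\<lambda>t. fst (snd t)) S
     \<and> acyclic (link_rel S)"

lemma path_forest_link_rel: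
  assumes "path_forest m S"
  shows "single_valued (link_rel S)" "single_valued ((link_rel S)\<inverse>)" "acyclic (link_rel S)"
  using assms by (force simp: path_forest_def link_rel_def single_valued_def inj_on_def)+

lemma path_forest_finite:
  fixes S :: "('a::finite \<times> 'a \<times> nat) set"
  shows "path_forest m S \<Longrightarrow> finite S"
  unfolding path_forest_def by (meson finite finite_imageD)

lemma path_forest_subset:
  assumes "path_forest m S" "T \<subseteq> S"
  shows "path_forest m T"
proof -
  have "link_rel T \<subseteq> link_rel S"
    using assms(2) by (auto simp: link_rel_def)
  then show ?thesis
    using assms unfolding path_forest_def by (meson acyclic_subset inj_on_subset subsetD)
qed

text \<open>
  A new arc keeps degrees and acyclicity precisely when it runs from the last vertex of a path to
  the first vertex of a different path.
\<close>

lemma path_forest_insert: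
  assumes "(a, b, g) \<notin> S"
  shows "path_forest m (insert (a, b, g) S) \<longleftrightarrow> path_forest m S \<and> g < m \<and>
    a \<notin> Domain (link_rel S) \<and> b \<notin> Range (link_rel S) \<and> (b, a) \<notin> (link_rel S)\<^sup>*"
proof -
  have "link_rel (insert (a, b, g) S) = insert (a, b) (link_rel S)"
    by (auto simp: link_rel_def)
  moreover have "a \<in> fst ` S \<longleftrightarrow> a \<in> Domain (link_rel S)"
    "b \<in> (\<lambda>t. fst (snd t)) ` S \<longleftrightarrow> b \<in> Range (link_rel S)"
    by (force simp: link_rel_def)+
  ultimately show ?thesis
    using assms by (auto simp: path_forest_def acyclic_insert)
qed

lemma path_forest_card:
  assumes "path_forest m S"
  shows "card (Domain (link_rel S)) = card S" "card (Range (link_rel S)) = card S"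
proof -
  have "Domain (link_rel S) = fst ` S" "Range (link_rel S) = (\<lambda>t. fst (snd t)) ` S"
    by (force simp: link_rel_def)+
  then show "card (Domain (link_rel S)) = card S" "card (Range (link_rel S)) = card S"
    using assms by (auto simp: path_forest_def card_image)
qed

text \<open>
  Following arcs backwards from \<open>a\<close> leaves no choice and must stop, so each vertex determines the
  first vertex of its path.
\<close>

lemma unique_path_source:
  fixes r :: "('a::finite \<times> 'a) set"
  assumes "acyclic r" "single_valued (r\<inverse>)"
  shows "\<exists>!b. b \<notin> Range r \<and> (b, a) \<in> r\<^sup>*"
proof -
  have "wf r"
    using assms(1) by (simp add: finite_acyclic_wf)
  then obtain b where b: "(b, a) \<in> r\<^sup>*" "\<And>c. (c, b) \<in> r \<Longrightarrow> (c, a) \<notin> r\<^sup>*"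
    using wfE_min[of r a "{c. (c, a) \<in> r\<^sup>*}"] by auto
  have "b \<notin> Range r"
    using b by (meson Range_iff converse_rtrancl_into_rtrancl)
  moreover have "b' = b" if "b' \<notin> Range r" "(b', a) \<in> r\<^sup>*" for b'
  proof -
    have "(b, b') \<in> r\<^sup>* \<or> (b', b) \<in> r\<^sup>*"
      using single_valued_confluent[OF assms(2), of a b b'] b(1) that(2)
      by (auto simp: rtrancl_converse)
    then show ?thesis
      using that(1) \<open>b \<notin> Range r\<close> by (metis RangeI rtranclE)
  qed
  ultimately show ?thesis
    using b(1) by blast
qed

text \<open>
  There are as many paths as vertices without an outgoing arc, or without an incoming one, namely
  \<open>n - card S\<close>. A new arc may start at any last vertex and end at any first vertex except that of
  its own path, with any of the \<open>m\<close> labels.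
\<close>

lemma card_path_forest_extensions:
  fixes S :: "('a::finite \<times> 'a \<times> nat) set"
  assumes S: "path_forest m S"
  shows "card {t. t \<notin> S \<and> path_forest m (insert t S)}
    = m * (CARD('a) - card S) * (CARD('a) - card S - 1)"
proof -
  let ?r = "link_rel S"
  have "card (- A) = CARD('a) - card A" for A :: "'a set"
    by (metis Compl_eq_Diff_UNIV card_Diff_subset finite subset_UNIV)
  then have fresh: "card (- Domain ?r) = CARD('a) - card S" "card (- Range ?r) = CARD('a) - card S"
    using path_forest_card[OF S] by simp_all
  define heads where "heads a = {b. b \<notin> Range ?r \<and> (b, a) \<notin> ?r\<^sup>*}" for a
  have heads: "card (heads a) = CARD('a) - card S - 1" for a
  proof -
    obtain b where b: "b \<notin> Range ?r" "(b, a) \<in> ?r\<^sup>*"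
      and unique: "\<And>c. c \<notin> Range ?r \<Longrightarrow> (c, a) \<in> ?r\<^sup>* \<Longrightarrow> c = b"
      using unique_path_source[OF path_forest_link_rel(3,2)[OF S], of a] by (elim ex1E) blast
    have "heads a = (- Range ?r) - {b}"
      unfolding heads_def using b unique by blast
    then show ?thesis
      using b(1) fresh(2) by (simp add: card_Diff_singleton)
  qed
  have "{t. t \<notin> S \<and> path_forest m (insert t S)}
      = (SIGMA a : - Domain ?r. heads a \<times> {..<m})" (is "?L = ?R")
  proof -
    have "(a, b, g) \<in> ?L \<longleftrightarrow> (a, b, g) \<in> ?R" for a b g
    proof (cases "(a, b, g) \<in> S")
      case True
      then have "a \<in> Domain ?r"
        by (auto simp: link_rel_def)
      with True show ?thesis by simp
    next
      case False
      with S show ?thesis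
        by (auto simp: path_forest_insert heads_def)
    qed
    then show ?thesis
      by auto
  qed
  then show ?thesis
    by (simp add: heads fresh)
qed

definition path_forests :: "nat \<Rightarrow> nat \<Rightarrow> ('a \<times> 'a \<times> nat) set set" where
  "path_forests m e = {S. path_forest m S \<and> card S = e}"

lemma finite_path_forests: "finite (path_forests m e :: ('a::finite \<times> 'a \<times> nat) set set)"
proof -
  have "(path_forests m e :: ('a \<times> 'a \<times> nat) set set) \<subseteq> Pow (UNIV \<times> UNIV \<times> {..<m})"
    by (auto simp: path_forests_def path_forest_def)
  then show ?thesis
    by (rule finite_subset) simp
qed

text \<open>
  Both sides count pairs of a forest with \<open>e + 1\<close> arcs and a distinguished arc: on the right, such a
  pair is built from the forest that remains when the distinguished arc is deleted.
\<close>

lemma card_path_forests_step: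
  "Suc e * card (path_forests m (Suc e) :: ('a::finite \<times> 'a \<times> nat) set set)
    = m * (CARD('a) - e) * (CARD('a) - e - 1) * card (path_forests m e :: ('a \<times> 'a \<times> nat) set set)"
proof -
  let ?up = "SIGMA S : (path_forests m e :: ('a \<times> 'a \<times> nat) set set).
    {t. t \<notin> S \<and> path_forest m (insert t S)}"
  let ?down = "SIGMA S : (path_forests m (Suc e) :: ('a \<times> 'a \<times> nat) set set). S"
  have fin: "finite S" if "S \<in> path_forests m e'" for S :: "('a \<times> 'a \<times> nat) set" and e'
    using that path_forest_finite by (auto simp: path_forests_def)
  have "bij_betw (\<lambda>(S, t). (insert t S, t)) ?up ?down"
  proof (rule bij_betw_byWitness[where f' = "\<lambda>(S, t). (S - {t}, t)"])
    show "(\<lambda>(S, t). (insert t S, t)) ` ?up \<subseteq> ?down"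
      using fin by (auto simp: path_forests_def)
    show "(\<lambda>(S, t). (S - {t}, t)) ` ?down \<subseteq> ?up"
      using fin by (auto simp: path_forests_def insert_absorb intro: path_forest_subset)
  qed auto
  then have "card ?up = card ?down"
    by (rule bij_betw_same_card)
  moreover have "card ?down = Suc e * card (path_forests m (Suc e) :: ('a \<times> 'a \<times> nat) set set)"
    using fin by (subst card_SigmaI[OF finite_path_forests]) (auto simp: path_forests_def)
  moreover have "card ?up = (\<Sum>S\<in>(path_forests m e :: ('a \<times> 'a \<times> nat) set set).
      m * (CARD('a) - e) * (CARD('a) - e - 1))"
  proof (subst card_SigmaI)
    show "\<forall>S \<in> (path_forests m e :: ('a \<times> 'a \<times> nat) set set).
        finite {t. t \<notin> S \<and> path_forest m (insert t S)}"
    proof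
      fix S :: "('a \<times> 'a \<times> nat) set"
      have "{t. t \<notin> S \<and> path_forest m (insert t S)} \<subseteq> UNIV \<times> UNIV \<times> {..<m}"
        by (auto simp: path_forest_def)
      then show "finite {t. t \<notin> S \<and> path_forest m (insert t S)}"
        by (rule finite_subset) simp
    qed
  next
    show "finite (path_forests m e :: ('a \<times> 'a \<times> nat) set set)"
      by (rule finite_path_forests)
  qed (auto simp: path_forests_def card_path_forest_extensions intro!: sum.cong)
  ultimately show ?thesis
    by (simp add: mult.commute)
qed

lemma card_path_forests:
  assumes "e < CARD('a::finite)"
  shows "card (path_forests m e :: ('a \<times> 'a \<times> nat) set set)
      * (fact (CARD('a) - e) * fact (CARD('a) - e - 1) * fact e)
    = m ^ e * (fact (CARD('a)) * fact (CARD('a) - 1))"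
  using assms
proof (induction e)
  case 0
  have "path_forest m ({} :: ('a \<times> 'a \<times> nat) set)"
    by (simp add: path_forest_def link_rel_def acyclic_def)
  then have "path_forests m 0 = {{} :: ('a \<times> 'a \<times> nat) set}"
    using path_forest_finite by (force simp: path_forests_def card_eq_0_iff)
  then show ?case by simp
next
  case (Suc e)
  let ?f = "\<lambda>e. card (path_forests m e :: ('a \<times> 'a \<times> nat) set set)"
  \<comment> \<open>Writing the truncated differences as successors lets the factorials unfold.\<close>
  define d where "d = CARD('a) - e - 2"
  have d: "CARD('a) - e = Suc (Suc d)"
    using Suc.prems by (simp add: d_def)
  have d': "CARD('a) - Suc e = Suc d" "CARD('a) - e - 1 = Suc d" "CARD('a) - Suc e - 1 = d"
    using d by linarith+
  have telescope: "A * (fact (Suc d) * fact d * fact (Suc e)) = m * (B * (fact (Suc (Suc d)) * fact (Suc d) * fact e))"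
    if step: "Suc e * A = m * Suc (Suc d) * Suc d * B" for A B :: nat
  proof -
    have "A * (fact (Suc d) * fact d * fact (Suc e)) = (Suc e * A) * (fact (Suc d) * fact d * fact e)"
      by (simp only: fact_Suc of_nat_id mult_ac)
    also have "\<dots> = m * (B * (fact (Suc (Suc d)) * fact (Suc d) * fact e))"
      unfolding step by (simp only: fact_Suc of_nat_id mult_ac)
    finally show ?thesis .
  qed
  have "?f e * (fact (Suc (Suc d)) * fact (Suc d) * fact e)
      = m ^ e * (fact (CARD('a)) * fact (CARD('a) - 1))"
    using Suc.IH[OF Suc_lessD[OF Suc.prems]] unfolding d diff_Suc_1 .
  then show ?case
    using telescope[OF card_path_forests_step[of e m, where 'a = 'a, unfolded d' d diff_Suc_1]]
    unfolding d' by (simp only: power_Suc mult.assoc diff_Suc_1)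
qed

section \<open>Systems of difference equations\<close>

definition difference_sols :: "('n \<times> 'n \<times> real) set \<Rightarrow> (real ^ 'n::finite) set" where
  "difference_sols D = {x. \<forall>(i, j, c) \<in> D. x $ j - x $ i = c}"

definition linked :: "('a \<times> 'a \<times> 'c) set \<Rightarrow> ('a \<times> 'a) set" where
  "linked D = (link_rel D \<union> (link_rel D)\<inverse>)\<^sup>*"

lemma linked_sym: "(i, j) \<in> linked D \<Longrightarrow> (j, i) \<in> linked D"
  unfolding linked_def by (meson sym_Un_converse sym_rtrancl symD)

text \<open>
  No equation leaves a connected component, so translating all coordinates of one component
  preserves every equation. So only differences within a component are determined by the system.
\<close>

lemma difference_sols_shift:
  fixes x :: "real ^ 'n::finite"
  assumes "x \<in> difference_sols D"
  shows "(\<chi> l. x $ l + t * of_bool ((j, l) \<in> linked D)) \<in> difference_sols D"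
proof -
  have "(j, p) \<in> linked D \<longleftrightarrow> (j, q) \<in> linked D" if "(p, q, c) \<in> D" for p q c
  proof -
    have "(p, q) \<in> link_rel D \<union> (link_rel D)\<inverse>" "(q, p) \<in> link_rel D \<union> (link_rel D)\<inverse>"
      using that by (auto simp: link_rel_def)
    then show ?thesis
      unfolding linked_def by (meson rtrancl.rtrancl_into_rtrancl)
  qed
  then show ?thesis
    using assms by (fastforce simp: difference_sols_def)
qed

lemma linked_if_constant_difference:
  fixes x :: "real ^ 'n::finite"
  assumes x: "x \<in> difference_sols D"
    and const: "\<And>y. y \<in> difference_sols D \<Longrightarrow> y $ j - y $ i = d"
  shows "(i, j) \<in> linked D"
proof (rule ccontr)
  assume "(i, j) \<notin> linked D"
  then have "(j, i) \<notin> linked D" "(j, j) \<in> linked D"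
    using linked_sym[of j i D] by (auto simp: linked_def)
  then show False
    using const[OF difference_sols_shift[OF x, of 1 j]] const[OF x] by simp
qed

lemma constant_difference_if_linked:
  assumes "(i, j) \<in> linked D"
  shows "\<exists>d. \<forall>x \<in> difference_sols D. x $ j - x $ i = d"
  using assms unfolding linked_def
proof (induction rule: rtrancl_induct)
  case base
  then show ?case by auto
next
  case (step p q)
  then obtain d where d: "\<forall>x \<in> difference_sols D. x $ p - x $ i = d"
    by blast
  obtain c where "\<forall>x \<in> difference_sols D. x $ q - x $ p = c"
  proof -
    from step(2) obtain c where "(p, q, c) \<in> D \<or> (q, p, c) \<in> D"
      by (auto simp: link_rel_def)
    then have "(\<forall>x \<in> difference_sols D. x $ q - x $ p = c) \<or> (\<forall>x \<in> difference_sols D. x $ q - x $ p = - c)"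
      by (fastforce simp: difference_sols_def)
    then show ?thesis using that by blast
  qed
  with d have "\<forall>x \<in> difference_sols D. x $ q - x $ i = c + d"
    by force
  then show ?case by blast
qed

section \<open>The order that a flat induces on the indices\<close>

text \<open>
  Since \<open>precedes F\<close> only relates indices whose coordinates have a constant difference on \<open>F\<close>, it is,
  for nonempty \<open>F\<close>, a strict order that is total on each block of such indices: the order by height, with ties broken
  by index.
\<close>

definition precedes :: "(real ^ 'n::{finite,linorder}) set \<Rightarrow> 'n \<Rightarrow> 'n \<Rightarrow> bool" where
  "precedes F i j \<longleftrightarrow> (\<exists>d. (\<forall>x \<in> F. x $ j - x $ i = d) \<and> (0 < d \<or> d = 0 \<and> i < j))"

definition covers :: "(real ^ 'n::{finite,linorder}) set \<Rightarrow> 'n \<Rightarrow> 'n \<Rightarrow> bool" where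
  "covers F i j \<longleftrightarrow> precedes F i j \<and> (\<nexists>l. precedes F i l \<and> precedes F l j)"

lemma precedesD:
  "precedes F i j \<Longrightarrow> x \<in> F \<Longrightarrow> x $ i < x $ j \<or> x $ i = x $ j \<and> i < j"
  by (auto simp: precedes_def)

lemma precedes_const:
  "precedes F i j \<Longrightarrow> \<exists>d. \<forall>x \<in> F. x $ j - x $ i = d"
  by (auto simp: precedes_def)

lemma precedesI:
  assumes "\<forall>x \<in> F. x $ j - x $ i = d" "x \<in> F" "x $ i < x $ j \<or> x $ i = x $ j \<and> i < j"
  shows "precedes F i j"
  using assms by (force simp: precedes_def intro!: exI[of _ d])

lemma precedes_irrefl: "F \<noteq> {} \<Longrightarrow> \<not> precedes F i i"
  using precedesD by fastforce

lemma precedes_trans: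
  assumes "precedes F i j" "precedes F j l"
  shows "precedes F i l"
proof -
  obtain d e where "\<forall>x \<in> F. x $ j - x $ i = d" "0 < d \<or> d = 0 \<and> i < j"
    "\<forall>x \<in> F. x $ l - x $ j = e" "0 < e \<or> e = 0 \<and> j < l"
    using assms unfolding precedes_def by blast
  then show ?thesis
    unfolding precedes_def by (intro exI[of _ "d + e"]) force
qed

lemma precedes_total:
  assumes "F \<noteq> {}" "\<forall>x \<in> F. x $ j - x $ i = d" "i \<noteq> j"
  shows "precedes F i j \<or> precedes F j i"
proof -
  obtain x where x: "x \<in> F" using assms(1) by blast
  have "\<forall>x \<in> F. x $ i - x $ j = - d"
    using assms(2) by force
  then show ?thesis
    using precedesI[OF assms(2) x] precedesI[of F i j "- d" x] x assms(3)
    by (meson linorder_less_linear)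
qed

lemma precedes_comparable:
  assumes "F \<noteq> {}" "precedes F i j \<or> precedes F j i" "precedes F i l \<or> precedes F l i" "j \<noteq> l"
  shows "precedes F j l \<or> precedes F l j"
proof -
  obtain d e where "\<forall>x \<in> F. x $ j - x $ i = d" "\<forall>x \<in> F. x $ l - x $ i = e"
  proof -
    have "\<exists>d. \<forall>x \<in> F. x $ p - x $ i = d" if "precedes F i p \<or> precedes F p i" for p
      using that by (metis precedes_const minus_diff_eq)
    then show ?thesis using that assms(2,3) by metis
  qed
  then have "\<forall>x \<in> F. x $ l - x $ j = e - d"
    by force
  then show ?thesis
    using precedes_total[OF assms(1)] assms(4) by blast
qed

text \<open>
  The order is finite, so refining a comparison as long as something lies strictly in between ends
  in a chain of covers.
\<close>

lemma precedes_cover_chain: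
  fixes F :: "(real ^ 'n::{finite,linorder}) set"
  assumes "F \<noteq> {}" "precedes F i j"
  shows "(i, j) \<in> {(a, b). covers F a b}\<^sup>+"
  using assms(2)
proof (induction "card {l. precedes F i l \<and> precedes F l j}" arbitrary: i j rule: less_induct)
  case less
  show ?case
  proof (cases "covers F i j")
    case False
    then obtain l where l: "precedes F i l" "precedes F l j"
      using less.prems by (auto simp: covers_def)
    have "{p. precedes F i p \<and> precedes F p l} \<subset> {p. precedes F i p \<and> precedes F p j}"
      "{p. precedes F l p \<and> precedes F p j} \<subset> {p. precedes F i p \<and> precedes F p j}"
      using l precedes_irrefl[OF assms(1)] precedes_trans by blast+
    then have "(i, l) \<in> {(a, b). covers F a b}\<^sup>+" "(l, j) \<in> {(a, b). covers F a b}\<^sup>+"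
      using less.hyps l by (simp_all add: psubset_card_mono)
    then show ?thesis by (rule trancl_trans)
  qed auto
qed

section \<open>From path forests to flats\<close>

text \<open>
  The correction \<open>[b < a]\<close> reflects the asymmetric range \<open>{1 - m..m}\<close> of the arrangement. It makes
  labels \<open>g < m\<close> correspond to hyperplanes in either case: \<open>x\<^sub>a - x\<^sub>b = - g\<close> if \<open>a < b\<close>, and
  \<open>x\<^sub>b - x\<^sub>a = g + 1\<close> if \<open>b < a\<close>. It also makes \<open>b\<close> come after \<open>a\<close> in the order by height and index.
\<close>

definition flat_of :: "('n \<times> 'n \<times> nat) set \<Rightarrow> (real ^ 'n::{finite,linorder}) set" where
  "flat_of S = {x. \<forall>(a, b, g) \<in> S. x $ b - x $ a = real g + of_bool (b < a)}"

text \<open>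
  Inverse to \<open>flat_of\<close>: the arcs are the covers of the order \<open>precedes F\<close>, which depends on the set
  \<open>F\<close> alone.
\<close>

definition arcs_of :: "(real ^ 'n::{finite,linorder}) set \<Rightarrow> ('n \<times> 'n \<times> nat) set" where
  "arcs_of F = {(a, b, g). covers F a b \<and> (\<forall>x \<in> F. x $ b - x $ a = real g + of_bool (b < a))}"

lemma flat_of_difference_sols:
  "flat_of S = difference_sols ((\<lambda>(a, b, g). (a, b, real g + of_bool (b < a))) ` S)"
  by (force simp: flat_of_def difference_sols_def)

text \<open>
  In a path, two vertices are connected only along the path, hence one is reachable from the other.
\<close>

lemma path_forest_linked:
  assumes S: "path_forest m S" and "(i, j) \<in> linked S"
  shows "(i, j) \<in> (link_rel S)\<^sup>* \<or> (j, i) \<in> (link_rel S)\<^sup>*"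
  using assms(2) unfolding linked_def
proof (induction rule: rtrancl_induct)
  case (step p q)
  note sv = path_forest_link_rel(1,2)[OF S]
  have out: "(p, i) \<in> (link_rel S)\<^sup>* \<Longrightarrow> (p, q) \<in> link_rel S \<Longrightarrow> ?case"
    using single_valued_confluent[OF sv(1), of p i q] by blast
  have "in": "(i, p) \<in> (link_rel S)\<^sup>* \<Longrightarrow> (q, p) \<in> link_rel S \<Longrightarrow> ?case"
    using single_valued_confluent[OF sv(2), of p i q] by (auto simp: rtrancl_converse)
  show ?case
    using step out "in" by (auto intro: rtrancl_into_rtrancl converse_rtrancl_into_rtrancl)
qed simp

lemma flat_of_constant_difference:
  assumes "path_forest m S" "x \<in> flat_of S" "\<forall>y \<in> flat_of S. y $ j - y $ i = d"
  shows "(i, j) \<in> (link_rel S)\<^sup>* \<or> (j, i) \<in> (link_rel S)\<^sup>*"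
proof -
  let ?D = "(\<lambda>(a, b, g). (a, b, real g + of_bool (b < a))) ` S"
  have "(i, j) \<in> linked ?D"
    using assms(2,3) linked_if_constant_difference[of x ?D j i d]
    unfolding flat_of_difference_sols by blast
  moreover have "link_rel ?D = link_rel S"
    by (force simp: link_rel_def)
  ultimately have "(i, j) \<in> linked S"
    by (simp add: linked_def)
  then show ?thesis
    by (rule path_forest_linked[OF assms(1)])
qed

text \<open>
  Induction on the arcs. A new arc joins two different components, so the difference it prescribes
  takes more than one value on the old flat. On an affine set it then takes every value, and fixing
  it cuts the flat in a nonempty set of dimension one less.
\<close>

lemma flat_of_dim:
  fixes S :: "('n::{finite,linorder} \<times> 'n \<times> nat) set"
  assumes "path_forest m S"
  shows "flat_of S \<noteq> {} \<and> aff_dim (flat_of S) = int CARD('n) - int (card S)"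
proof -
  have "finite S"
    using assms by (rule path_forest_finite)
  then show ?thesis
    using assms
  proof (induction S rule: finite_induct)
    case empty
    then show ?case by (simp add: flat_of_def)
  next
    case (insert t S)
    obtain a b g where t: "t = (a, b, g)"
      by (cases t)
    have S: "path_forest m S" and ab: "a \<notin> Domain (link_rel S)" "b \<notin> Range (link_rel S)"
      "(b, a) \<notin> (link_rel S)\<^sup>*"
      using insert.prems insert.hyps(2) by (simp_all add: t path_forest_insert)
    define c where "c = real g + of_bool (b < a)"
    define v where "v = (axis b 1 - axis a 1 :: (real, 'n) vec)"
    have v: "v \<bullet> x = x $ b - x $ a" for x
      by (simp add: v_def inner_diff_left inner_axis')
    have eq: "flat_of (insert t S) = flat_of S \<inter> {x. v \<bullet> x = c}"
      unfolding v by (auto simp: flat_of_def t c_def)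
    obtain x where x: "x \<in> flat_of S"
      using insert.IH[OF S] by blast
    have unlinked: "(a, b) \<notin> (link_rel S)\<^sup>* \<and> (b, a) \<notin> (link_rel S)\<^sup>*"
      using ab by (metis DomainI converse_rtranclE rtrancl.rtrancl_refl)
    then have free: "\<exists>y \<in> flat_of S. y $ b - y $ a \<noteq> d" for d
      using flat_of_constant_difference[OF S x, of b a d] by blast
    have aff: "affine (flat_of S)"
      unfolding affine_def
    proof (intro ballI allI impI)
      fix y z :: "(real, 'n) vec" and u w :: real
      assume yz: "y \<in> flat_of S" "z \<in> flat_of S" and uw: "u + w = 1"
      have "(u *\<^sub>R y + w *\<^sub>R z) $ q - (u *\<^sub>R y + w *\<^sub>R z) $ p = real h + of_bool (q < p)"
        if "(p, q, h) \<in> S" for p q h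
      proof -
        have "y $ q - y $ p = real h + of_bool (q < p)" "z $ q - z $ p = real h + of_bool (q < p)"
          using yz that by (auto simp: flat_of_def)
        moreover have "(u *\<^sub>R y + w *\<^sub>R z) $ q - (u *\<^sub>R y + w *\<^sub>R z) $ p
            = u * (y $ q - y $ p) + w * (z $ q - z $ p)"
          by (simp add: algebra_simps)
        ultimately show ?thesis
          using uw by (simp flip: distrib_right)
      qed
      then show "u *\<^sub>R y + w *\<^sub>R z \<in> flat_of S"
        by (auto simp: flat_of_def)
    qed
    have "flat_of (insert t S) \<noteq> {}"
    proof -
      obtain y where y: "y \<in> flat_of S" "y $ b - y $ a \<noteq> x $ b - x $ a"
        using free by blast
      \<comment> \<open>The point of the line through \<open>x\<close> and \<open>y\<close> where the difference equals \<open>c\<close>.\<close>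
      define s where "s = (c - (x $ b - x $ a)) / ((y $ b - y $ a) - (x $ b - x $ a))"
      define z where "z = (1 - s) *\<^sub>R x + s *\<^sub>R y"
      have "z \<in> flat_of S"
        using aff x y unfolding affine_def z_def by simp
      moreover have "z $ b - z $ a = (x $ b - x $ a) + s * ((y $ b - y $ a) - (x $ b - x $ a))"
        by (simp add: z_def algebra_simps)
      then have "z $ b - z $ a = c"
        using y(2) by (simp add: s_def)
      ultimately show ?thesis
        unfolding eq v by blast
    qed
    moreover have "\<not> flat_of S \<subseteq> {x. v \<bullet> x = c}"
      using free[of c] by (auto simp: v)
    ultimately show ?case
      using aff_dim_affine_Int_hyperplane[OF aff, of v c] insert.IH[OF S] insert.hyps
      by (simp add: eq)
  qed
qed

lemma flat_of_in_flats:
  fixes S :: "('n::{finite,linorder} \<times> 'n \<times> nat) set"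
  assumes S: "path_forest m S"
  shows "flat_of S \<in> flats (ext_shi_arrangement m)"
proof -
  define H where "H = (\<lambda>(a, b, g). {x :: (real, 'n) vec. x $ b - x $ a = real g + of_bool (b < a)})"
  have "H (a, b, g) \<in> ext_shi_arrangement m" if t: "(a, b, g) \<in> S" for a b g
  proof -
    have g: "g < m"
      using S t by (auto simp: path_forest_def)
    have "(a, b) \<in> link_rel S"
      using t by (auto simp: link_rel_def)
    then have "a \<noteq> b"
      using path_forest_link_rel(3)[OF S] by (auto simp: acyclic_def)
    then consider "a < b" | "b < a"
      by force
    then show ?thesis
    proof cases
      case 1
      then have "H (a, b, g) = {x. x $ a - x $ b = of_int (- int g)}"
        by (auto simp: H_def)
      then show ?thesis
        using 1 g unfolding ext_shi_arrangement_def
        by (intro CollectI exI[of _ a] exI[of _ b] exI[of _ "- int g"]) simp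
    next
      case 2
      then have "H (a, b, g) = {x. x $ b - x $ a = of_int (int g + 1)}"
        by (auto simp: H_def)
      then show ?thesis
        using 2 g unfolding ext_shi_arrangement_def
        by (intro CollectI exI[of _ b] exI[of _ a] exI[of _ "int g + 1"]) simp
    qed
  qed
  then have "H ` S \<subseteq> ext_shi_arrangement m"
    by auto
  moreover have "flat_of S = \<Inter> (H ` S)"
    by (auto simp: flat_of_def H_def)
  moreover have "flat_of S \<noteq> {}"
    using flat_of_dim[OF S] by blast
  ultimately show ?thesis
    unfolding flats_def by (metis (mono_tags, lifting) mem_Collect_eq)
qed

text \<open>
  Arcs go upwards in the order \<open>precedes\<close>. Conversely, comparable indices have a constant difference
  and so lie on a common path, and the order on a path is reachability. The covers are therefore
  exactly the arcs, and a label can be read off from any point of the flat.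
\<close>

lemma arcs_of_flat_of:
  fixes S :: "('n::{finite,linorder} \<times> 'n \<times> nat) set"
  assumes S: "path_forest m S"
  shows "arcs_of (flat_of S) = S"
proof -
  let ?F = "flat_of S" and ?r = "link_rel S"
  have F: "?F \<noteq> {}"
    using flat_of_dim[OF S] by blast
  then obtain x where x: "x \<in> ?F"
    by blast
  have gap: "\<forall>x \<in> ?F. x $ b - x $ a = real g + of_bool (b < a)" if "(a, b, g) \<in> S" for a b g
    using that by (auto simp: flat_of_def)
  have arc: "precedes ?F a b" if ab: "(a, b) \<in> ?r" for a b
  proof -
    obtain g where g: "(a, b, g) \<in> S"
      using ab by (auto simp: link_rel_def)
    have "a \<noteq> b"
      using ab path_forest_link_rel(3)[OF S] by (auto simp: acyclic_def)
    then have "0 < real g + of_bool (b < a) \<or> real g + of_bool (b < a) = 0 \<and> a < b"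
      by auto
    then show ?thesis
      using gap[OF g] unfolding precedes_def by blast
  qed
  have path: "a = b \<or> precedes ?F a b" if "(a, b) \<in> ?r\<^sup>*" for a b
    using that by (induction rule: rtrancl_induct) (auto dest: arc intro: precedes_trans)
  have comparable: "(a, b) \<in> ?r\<^sup>*" if "precedes ?F a b" for a b
  proof -
    have "(a, b) \<in> ?r\<^sup>* \<or> (b, a) \<in> ?r\<^sup>*"
      using precedes_const[OF that] flat_of_constant_difference[OF S x] by blast
    then show ?thesis
      using that path precedes_irrefl[OF F] precedes_trans by blast
  qed
  have covers: "covers ?F a b \<longleftrightarrow> (a, b) \<in> ?r" for a b
  proof
    assume ab: "covers ?F a b"
    then have "(a, b) \<in> ?r\<^sup>*" "a \<noteq> b"
      using comparable precedes_irrefl[OF F] by (auto simp: covers_def)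
    then obtain c where "(a, c) \<in> ?r" "(c, b) \<in> ?r\<^sup>*"
      by (metis converse_rtranclE)
    then show "(a, b) \<in> ?r"
      using ab arc[of a c] path[of c b] by (auto simp: covers_def)
  next
    assume ab: "(a, b) \<in> ?r"
    have False if l: "precedes ?F a l" "precedes ?F l b" for l
    proof -
      have "(a, l) \<in> ?r\<^sup>*" "a \<noteq> l"
        using comparable l precedes_irrefl[OF F] by auto
      then obtain c where "(a, c) \<in> ?r" "(c, l) \<in> ?r\<^sup>*"
        by (metis converse_rtranclE)
      moreover from this have "c = b"
        using ab path_forest_link_rel(1)[OF S] by (auto simp: single_valued_def)
      ultimately show False
        using path l(2) precedes_irrefl[OF F] precedes_trans by blast
    qed
    then show "covers ?F a b"
      using arc[OF ab] by (auto simp: covers_def)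
  qed
  have "(a, b, g) \<in> arcs_of ?F \<longleftrightarrow> (a, b, g) \<in> S" for a b g
  proof
    assume abg: "(a, b, g) \<in> arcs_of ?F"
    then obtain h where h: "(a, b, h) \<in> S"
      using covers by (auto simp: arcs_of_def link_rel_def)
    then have "real g = real h"
      using abg gap[OF h] x by (auto simp: arcs_of_def)
    then show "(a, b, g) \<in> S"
      using h by simp
  next
    assume abg: "(a, b, g) \<in> S"
    then have "(a, b) \<in> ?r"
      by (auto simp: link_rel_def)
    then show "(a, b, g) \<in> arcs_of ?F"
      using gap[OF abg] covers by (auto simp: arcs_of_def)
  qed
  then show ?thesis
    by auto
qed

section \<open>From flats to path forests\<close>

text \<open>
  The triple \<open>(p, q, c)\<close> stands for the equation \<open>x\<^sub>q - x\<^sub>p = c\<close>, that is, for the hyperplane of the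
  arrangement with \<open>i = q\<close>, \<open>j = p\<close> and \<open>a = c\<close>.
\<close>

definition shi_system :: "nat \<Rightarrow> ('n::linorder \<times> 'n \<times> real) set \<Rightarrow> bool" where
  "shi_system m D \<longleftrightarrow> (\<forall>(p, q, c) \<in> D. q < p \<and> c \<in> \<int> \<and> 1 - real m \<le> c \<and> c \<le> real m)"

lemma flats_shi_system:
  fixes F :: "(real ^ 'n::{finite,linorder}) set"
  assumes "F \<in> flats (ext_shi_arrangement m)"
  obtains D where "shi_system m D" "F = difference_sols D" "F \<noteq> {}"
proof -
  obtain B where B: "F = \<Inter> B" "B \<subseteq> ext_shi_arrangement m" "F \<noteq> {}"
    using assms by (auto simp: flats_def)
  define D where "D = {(j, i, c). i < j \<and> c \<in> \<int> \<and> 1 - real m \<le> c \<and> c \<le> real m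
    \<and> {x :: (real, 'n) vec. x $ i - x $ j = c} \<in> B}"
  have "shi_system m D"
    by (auto simp: shi_system_def D_def)
  moreover have "F = difference_sols D"
  proof
    show "F \<subseteq> difference_sols D"
      unfolding B(1) by (auto simp: difference_sols_def D_def)
    show "difference_sols D \<subseteq> F"
      unfolding B(1)
    proof
      fix x :: "(real, 'n) vec"
      assume x: "x \<in> difference_sols D"
      show "x \<in> \<Inter> B"
      proof
        fix H assume H: "H \<in> B"
        then have "H \<in> ext_shi_arrangement m"
          using B(2) by blast
        then obtain i j a where ij: "H = {x. x $ i - x $ j = of_int a}" "i < j"
          "1 - int m \<le> a" "a \<le> int m"
          by (auto simp: ext_shi_arrangement_def)
        have "1 - real m \<le> of_int a" "of_int a \<le> real m"
          using ij(3,4) by linarith+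
        then have "(j, i, of_int a) \<in> D"
          using ij H by (simp add: D_def)
        then show "x \<in> H"
          using x by (auto simp: difference_sols_def ij(1))
      qed
    qed
  qed
  ultimately show ?thesis
    using that B(3) by blast
qed

lemma rtrancl_crossing:
  assumes "(a, b) \<in> r\<^sup>*" "P a" "\<not> P b"
  obtains p q where "(a, p) \<in> r\<^sup>*" "(p, q) \<in> r" "P p" "\<not> P q"
proof -
  have "P b \<or> (\<exists>p q. (a, p) \<in> r\<^sup>* \<and> (p, q) \<in> r \<and> P p \<and> \<not> P q)"
    using assms(1) by (induction rule: rtrancl_induct) (use assms(2) in blast)+
  then show ?thesis
    using that assms(3) by blast
qed

text \<open>
  The interval graph argument. Neighbours \<open>a\<close>, \<open>b\<close> in the order of a block are connected by equations
  of the system, and a path of equations from \<open>a\<close> to \<open>b\<close> has to cross from the indices up to \<open>a\<close> to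
  those from \<open>b\<close> on. The crossing equation spans the gap between \<open>a\<close> and \<open>b\<close>, and the constant of
  that equation bounds the gap by \<open>m\<close>. Only the case \<open>a < b\<close> needs the stronger bound \<open>m - 1\<close>: if
  the crossing difference \<open>x\<^sub>q - x\<^sub>p\<close> is \<open>m\<close>, then \<open>q < p\<close>, so a gap of \<open>m\<close> would give
  \<open>p \<le> a < b \<le> q\<close> by the tie-breaking rule, a contradiction.
\<close>

lemma shi_system_cover_gap:
  fixes D :: "('n::{finite,linorder} \<times> 'n \<times> real) set"
  assumes D: "shi_system m D" and F: "F = difference_sols D" "F \<noteq> {}" and ab: "covers F a b"
  shows "\<exists>g < m. \<forall>x \<in> F. x $ b - x $ a = real g + of_bool (b < a)"
proof -
  obtain x where x: "x \<in> F"
    using F(2) by blast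
  have prec: "precedes F a b"
    using ab by (simp add: covers_def)
  obtain d where d: "\<forall>x \<in> F. x $ b - x $ a = d"
    using precedes_const[OF prec] by blast
  have link: "(a, b) \<in> linked D"
    using linked_if_constant_difference[of x D b a d] x d F(1) by blast
  have edge: "(q < p \<and> x $ q - x $ p \<le> real m \<or> p < q \<and> x $ q - x $ p \<le> real m - 1)
      \<and> x $ q - x $ p \<in> \<int>" if pq: "(p, q) \<in> link_rel D \<union> (link_rel D)\<inverse>" for p q
  proof -
    obtain c where "(p, q, c) \<in> D \<or> (q, p, c) \<in> D"
      using pq by (auto simp: link_rel_def)
    then show ?thesis
    proof
      assume "(p, q, c) \<in> D"
      moreover from this have "x $ q - x $ p = c"
        using x F(1) by (auto simp: difference_sols_def)
      ultimately show ?thesis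
        using D by (auto simp: shi_system_def)
    next
      assume "(q, p, c) \<in> D"
      moreover from this have "x $ q - x $ p = - c"
        using x F(1) by (auto simp: difference_sols_def)
      ultimately show ?thesis
        using D by (auto simp: shi_system_def)
    qed
  qed
  have integral: "x $ b - x $ a \<in> \<int>"
    using link unfolding linked_def
  proof (induction rule: rtrancl_induct)
    case (step p q)
    then have "(x $ p - x $ a) + (x $ q - x $ p) \<in> \<int>"
      using edge by (blast intro: Ints_add)
    then show ?case by simp
  qed simp
  \<comment> \<open>The crossing edge: \<open>p\<close> is not above \<open>a\<close>, while \<open>q\<close> is above \<open>a\<close>, hence not below \<open>b\<close>.\<close>
  obtain p q where pq: "(a, p) \<in> linked D" "(p, q) \<in> link_rel D \<union> (link_rel D)\<inverse>"
    "p = a \<or> precedes F p a" "\<not> (q = a \<or> precedes F q a)"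
  proof -
    have "\<not> (b = a \<or> precedes F b a)"
      using prec precedes_irrefl[OF F(2)] precedes_trans by blast
    then show ?thesis
      using rtrancl_crossing[OF link[unfolded linked_def], of "\<lambda>c. c = a \<or> precedes F c a"] that
      unfolding linked_def by blast
  qed
  have bq: "b = q \<or> precedes F b q"
  proof -
    have "(a, q) \<in> linked D"
      using pq(1,2) unfolding linked_def by (rule rtrancl_into_rtrancl)
    then obtain e where "\<forall>x \<in> F. x $ q - x $ a = e"
      using constant_difference_if_linked F(1) by blast
    then have "precedes F a q"
      using precedes_total[OF F(2)] pq(4) by blast
    moreover from this have "\<not> precedes F q b"
      using ab by (auto simp: covers_def)
    ultimately show ?thesis
      using precedes_comparable[OF F(2), of a b q] prec by blast
  qed
  have order: "x $ p < x $ a \<or> x $ p = x $ a \<and> p \<le> a" "x $ b < x $ q \<or> x $ b = x $ q \<and> b \<le> q"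
    "x $ a < x $ b \<or> x $ a = x $ b \<and> a < b"
    using pq(3) bq prec precedesD[OF _ x] by (auto dest: less_imp_le)
  obtain z where z: "x $ b - x $ a = of_int z"
    using integral by (auto elim: Ints_cases)
  have "of_int z - of_bool (b < a) < real m"
    using edge[OF pq(2)] order z by auto
  then have up: "z - of_bool (b < a) < int m"
    by (cases "b < a") simp_all
  have low: "0 \<le> z - of_bool (b < a)"
  proof -
    have "0 < real_of_int z \<or> real_of_int z = 0 \<and> a < b"
      using order(3) z by linarith
    then show ?thesis
      by (auto simp: not_less)
  qed
  have "x $ b - x $ a = real (nat (z - of_bool (b < a))) + of_bool (b < a)"
    using z low by (simp add: of_nat_nat)
  then have "\<forall>y \<in> F. y $ b - y $ a = real (nat (z - of_bool (b < a))) + of_bool (b < a)"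
    using d x by simp
  then show ?thesis
    using up low by (intro exI[of _ "nat (z - of_bool (b < a))"]) simp
qed

text \<open>
  Covers in a union of chains form disjoint paths, and their labels are below \<open>m\<close> by the gap bound.
  The arcs determine the differences between covering neighbours, and adding these along a chain
  recovers every equation of the flat.
\<close>

lemma flat_is_flat_of:
  fixes F :: "(real ^ 'n::{finite,linorder}) set"
  assumes "F \<in> flats (ext_shi_arrangement m)"
  shows "path_forest m (arcs_of F) \<and> flat_of (arcs_of F) = F"
proof -
  obtain D where D: "shi_system m D" and F: "F = difference_sols D" "F \<noteq> {}"
    using flats_shi_system[OF assms] by blast
  obtain x where x: "x \<in> F"
    using F(2) by blast
  have arcs: "link_rel (arcs_of F) = {(a, b). covers F a b}"
    using shi_system_cover_gap[OF D F] by (fastforce simp: link_rel_def arcs_of_def)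
  have label: "g = h" if "(a, b, g) \<in> arcs_of F" "(a, b, h) \<in> arcs_of F" for a b g h
    using that x by (fastforce simp: arcs_of_def)
  have out: "b = c" if "covers F a b" "covers F a c" for a b c
    using that precedes_comparable[OF F(2), of a b c] by (auto simp: covers_def)
  have "in": "a = c" if "covers F a b" "covers F c b" for a b c
    using that precedes_comparable[OF F(2), of b a c] by (auto simp: covers_def)
  have "acyclic {(a, b). covers F a b}"
  proof (rule acyclic_subset)
    have "trans {(a, b). precedes F a b}"
      by (auto simp: trans_def intro: precedes_trans)
    then show "acyclic {(a, b). precedes F a b}"
      using precedes_irrefl[OF F(2)] by (auto simp: acyclic_def trancl_id)
  qed (auto simp: covers_def)
  moreover have "g < m" if abg: "(a, b, g) \<in> arcs_of F" for a b g
  proof -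
    obtain h where "h < m" "(a, b, h) \<in> arcs_of F"
      using abg shi_system_cover_gap[OF D F, of a b] by (auto simp: arcs_of_def)
    then show ?thesis
      using label abg by blast
  qed
  moreover have "inj_on fst (arcs_of F)"
  proof (rule inj_onI)
    fix s t assume st: "s \<in> arcs_of F" "t \<in> arcs_of F" "fst s = fst t"
    obtain a b g b' h where eqs: "s = (a, b, g)" "t = (a, b', h)"
      using st(3) by (cases s; cases t) auto
    have "b = b'"
      using out[of a b b'] st(1,2) by (auto simp: eqs arcs_of_def)
    then show "s = t"
      using label[of a b g h] st(1,2) by (simp add: eqs)
  qed
  moreover have "inj_on (\<lambda>t. fst (snd t)) (arcs_of F)"
  proof (rule inj_onI)
    fix s t assume st: "s \<in> arcs_of F" "t \<in> arcs_of F" "fst (snd s) = fst (snd t)"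
    obtain a b g a' h where eqs: "s = (a, b, g)" "t = (a', b, h)"
      using st(3) by (cases s; cases t) auto
    have "a = a'"
      using "in"[of a b a'] st(1,2) by (auto simp: eqs arcs_of_def)
    then show "s = t"
      using label[of a b g h] st(1,2) by (simp add: eqs)
  qed
  ultimately have "path_forest m (arcs_of F)"
    unfolding path_forest_def arcs by blast
  moreover have "flat_of (arcs_of F) \<subseteq> F"
  proof
    fix y assume y: "y \<in> flat_of (arcs_of F)"
    have cover: "y $ b - y $ a = x $ b - x $ a" if "covers F a b" for a b
    proof -
      have "(a, b) \<in> link_rel (arcs_of F)"
        using that arcs by simp
      then obtain g where "(a, b, g) \<in> arcs_of F"
        by (auto simp: link_rel_def)
      then show ?thesis
        using x y by (auto simp: flat_of_def arcs_of_def)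
    qed
    have prec: "y $ b - y $ a = x $ b - x $ a" if "precedes F a b" for a b
      using precedes_cover_chain[OF F(2) that]
    proof (induction rule: trancl_induct)
      case (step c d)
      then show ?case using cover[of c d] by simp
    qed (simp add: cover)
    have "y $ q - y $ p = c" if pqc: "(p, q, c) \<in> D" for p q c
    proof -
      have const: "\<forall>x \<in> F. x $ q - x $ p = c"
        using pqc F(1) by (auto simp: difference_sols_def)
      have "p \<noteq> q"
        using D pqc by (auto simp: shi_system_def)
      then have "y $ q - y $ p = x $ q - x $ p"
        using precedes_total[OF F(2) const] prec[of p q] prec[of q p] by auto
      then show ?thesis
        using const x by simp
    qed
    then show "y \<in> F"
      by (auto simp: F(1) difference_sols_def)
  qed
  moreover have "F \<subseteq> flat_of (arcs_of F)"
    by (auto simp: flat_of_def arcs_of_def)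
  ultimately show ?thesis
    by blast
qed

section \<open>The number of flats\<close>

lemma card_flats_of_dim:
  assumes "k \<le> CARD('n::{finite,linorder})"
  shows "card (flats_of_dim k (ext_shi_arrangement m :: (real ^ 'n::{finite,linorder}) set set))
    = card (path_forests m (CARD('n) - k) :: ('n \<times> 'n \<times> nat) set set)"
proof (rule bij_betw_same_card[symmetric], rule bij_betw_byWitness[where f' = arcs_of])
  let ?P = "path_forests m (CARD('n) - k) :: ('n \<times> 'n \<times> nat) set set"
  let ?F = "flats_of_dim k (ext_shi_arrangement m :: (real, 'n) vec set set)"
  show "\<forall>S \<in> ?P. arcs_of (flat_of S) = S"
    by (auto simp: path_forests_def arcs_of_flat_of)
  show "\<forall>F \<in> ?F. flat_of (arcs_of F) = F"
    by (auto simp: flats_of_dim_def flat_is_flat_of)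
  show "flat_of ` ?P \<subseteq> ?F"
    using assms by (auto simp: path_forests_def flats_of_dim_def flat_of_in_flats flat_of_dim)
  show "arcs_of ` ?F \<subseteq> ?P"
  proof
    fix S assume "S \<in> arcs_of ` ?F"
    then obtain F where F: "F \<in> flats (ext_shi_arrangement m)" "aff_dim F = int k" "S = arcs_of F"
      by (auto simp: flats_of_dim_def)
    then show "S \<in> ?P"
      using flat_is_flat_of[OF F(1)] flat_of_dim[of m S] by (auto simp: path_forests_def)
  qed
qed

theorem theorem1p17:
  fixes m n k :: nat
  assumes "m > 0" and "n > 0" and "k > 0"
    and "CARD('n::{finite,linorder}) = n"
  shows "real (card (flats_of_dim k (ext_shi_arrangement m :: (real ^ 'n::{finite,linorder}) set set))) =
    (if k \<le> n
     then real m ^ (n - k) * (fact n * fact (n - 1)) / (fact k * fact (k - 1) * fact (n - k))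
     else 0)"
proof (cases "k \<le> n")
  case True
  let ?f = "card (path_forests m (n - k) :: ('n \<times> 'n \<times> nat) set set)"
  have "?f * (fact k * fact (k - 1) * fact (n - k)) = m ^ (n - k) * (fact n * fact (n - 1))"
    using card_path_forests[where 'a = 'n, of "n - k" m] assms True by simp
  then have "real (?f * (fact k * fact (k - 1) * fact (n - k)))
      = real (m ^ (n - k) * (fact n * fact (n - 1)))"
    by (rule arg_cong)
  then have "real ?f = real m ^ (n - k) * (fact n * fact (n - 1)) / (fact k * fact (k - 1) * fact (n - k))"
    by (simp add: eq_divide_eq)
  then show ?thesis
    using True card_flats_of_dim[where 'n = 'n, of k m] assms(4) by simp
next
  case False
  have "aff_dim F \<noteq> int k" for F :: "(real, 'n) vec set"
    using aff_dim_le_DIM[of F] False assms(4) by simp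
  then have "flats_of_dim k (ext_shi_arrangement m :: (real, 'n) vec set set) = {}"
    by (auto simp: flats_of_dim_def)
  with False show ?thesis
    by simp
qed

end
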